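(* Assume that the discrete operator $L_h$ has the conservative flux form (with positive face coefficients) given in the context, that $$\tau_i=O(h^2),\qquad i\ne I,I+1,$$ and that the two interface truncation errors satisfy $$\tau_I=O(1),\qquad \tau_{I+1}=O(1),\qquad \tau_I+\tau_{I+1}=O(h).$$ Then $$\|U-u_h\|_\infty\le Ch^2,$$ where $C$ is independent of $h$.
   Context: Interface problem: let $a<\alpha<b$, $\beta(x)=\beta^->0$ for $x<\alpha$ and $\beta(x)=\beta^+>0$ for $x>\alpha$ (constants). The exact solution $u$ satisfies $-(\beta u_x)_x=f$ on $(a,\alpha)\cup(\alpha,b)$, $u(a)=u(b)=0$, $[u]_\alpha=w$, $[\beta u_x]_\alpha=v$, where $[g]_\alpha:=g(\alpha^+)-g(\alpha^-)$. Grid: $x_i=a+ih$, $0\le i\le n+1$, $h=(b-a)/(n+1)$, and $x_I<\alpha<x_{I+1}$ with $1\le I\le n-1$ ($I$ depends on $h$). Conservative flux form: for face coefficients $\beta_{i+\frac12}>0$, $i=0,\ldots,n$, $$(L_hU)_i=\frac1{h^2}\left[-\beta_{i-\frac12}U_{i-1}+(\beta_{i-\frac12}+\beta_{i+\frac12})U_i-\beta_{i+\frac12}U_{i+1}\right],\quad 1\le i\le n,\quad U_0=U_{n+1}=0.$$ The face coefficients may depend on $h$, but $\beta_{i+\frac12}\ge\beta_{\min}$ for all $i$ with a constant $\beta_{\min}>0$ independent of $h$. The numerical solution $U$ solves $L_hU=r_h$, where $r_h=(r_1^h,\ldots,r_n^h)^T$ is the assembled right-hand side: $r_i^h=f(x_i)$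 for $i\ne I,I+1$, while $r_I^h$ and $r_{I+1}^h$ may also contain correction terms coming from the jump data. The truncation error is $\tau:=L_hu_h-r_h$ with $u_h=(u(x_1),\ldots,u(x_n))^T$. All $O(\cdot)$ are as $h\to0$, with constants independent of $h$ and of the index $i$. $\|\cdot\|_\infty$ is the maximum norm. *)

theory Defs
  imports "HOL-Analysis.Analysis" "HOL-Library.Landau_Symbols"
begin

definition has_jump :: "(real \<Rightarrow> real) \<Rightarrow> real \<Rightarrow> real \<Rightarrow> bool" where
  "has_jump g \<alpha> d \<longleftrightarrow>
     (\<exists>l r. (g \<longlongrightarrow> l) (at_left \<alpha>) \<and> (g \<longlongrightarrow> r) (at_right \<alpha>) \<and> r - l = d)"

(* The value at the interface itself is immaterial: it is never used below. *)
definition pw_coeff :: "real \<Rightarrow> real \<Rightarrow> real \<Rightarrow> real \<Rightarrow> real" where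
  "pw_coeff \<alpha> \<beta>m \<beta>p x = (if x < \<alpha> then \<beta>m else \<beta>p)"

(* Classical solution of the interface problem.  Continuity up to the outer end points
   is what ties the boundary values to the solution inside the subintervals. *)
definition interface_solution ::
  "real \<Rightarrow> real \<Rightarrow> real \<Rightarrow> real \<Rightarrow> real \<Rightarrow> (real \<Rightarrow> real) \<Rightarrow> real \<Rightarrow> real \<Rightarrow> (real \<Rightarrow> real) \<Rightarrow> bool" where
  "interface_solution a \<alpha> b \<beta>m \<beta>p f w v u \<longleftrightarrow>
     continuous_on {a..<\<alpha>} u \<and> continuous_on {\<alpha><..b} u \<and>
     (\<forall>x \<in> {a<..<\<alpha>} \<union> {\<alpha><..<b}.
        u field_differentiable (at x) \<and>
        (\<lambda>y. pw_coeff \<alpha> \<beta>m \<beta>p y * deriv u y) field_differentiable (at x) \<and>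
        - deriv (\<lambda>y. pw_coeff \<alpha> \<beta>m \<beta>p y * deriv u y) x = f x) \<and>
     u a = 0 \<and> u b = 0 \<and>
     has_jump u \<alpha> w \<and>
     has_jump (\<lambda>x. pw_coeff \<alpha> \<beta>m \<beta>p x * deriv u x) \<alpha> v"

definition mesh :: "real \<Rightarrow> real \<Rightarrow> nat \<Rightarrow> real" where
  "mesh a b n = (b - a) / (real n + 1)"

definition grid :: "real \<Rightarrow> real \<Rightarrow> nat \<Rightarrow> nat \<Rightarrow> real" where
  "grid a b n i = a + real i * mesh a b n"

(* Grid vectors of length n are functions on nat of which only the entries 1, ..., n
   matter; zero_ext adds the homogeneous boundary values at the indices 0 and n + 1. *)
definition zero_ext :: "nat \<Rightarrow> (nat \<Rightarrow> real) \<Rightarrow> nat \<Rightarrow> real" where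
  "zero_ext n U i = (if i \<in> {1..n} then U i else 0)"

(* The face coefficient at i + 1/2 is written B i, for i = 0, ..., n, so B (i - 1)
   belongs to the face i - 1/2.  Intended for row indices i in {1..n} only. *)
definition flux_op :: "real \<Rightarrow> nat \<Rightarrow> (nat \<Rightarrow> real) \<Rightarrow> (nat \<Rightarrow> real) \<Rightarrow> nat \<Rightarrow> real" where
  "flux_op h n B U i =
     1 / h\<^sup>2 * (- B (i - 1) * zero_ext n U (i - 1)
               + (B (i - 1) + B i) * zero_ext n U i
               - B i * zero_ext n U (i + 1))"

definition trunc_error ::
  "real \<Rightarrow> real \<Rightarrow> nat \<Rightarrow> (nat \<Rightarrow> real) \<Rightarrow> (nat \<Rightarrow> real) \<Rightarrow> (real \<Rightarrow> real) \<Rightarrow> nat \<Rightarrow> real" where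
  "trunc_error a b n B r u i = flux_op (mesh a b n) n B (\<lambda>j. u (grid a b n j)) i - r i"

definition max_norm :: "nat \<Rightarrow> (nat \<Rightarrow> real) \<Rightarrow> real" where
  "max_norm n V = Max ((\<lambda>i. \<bar>V i\<bar>) ` {1..n})"

(* The limit h \<rightarrow> 0 along the family of grids with n in N interior points.  A grid may have to
   be left out because the interface hits one of its nodes, so N need not be all of nat. *)
definition refine :: "nat set \<Rightarrow> nat filter" where
  "refine N = inf sequentially (principal N)"

end

theory Submission
  imports Defs
begin

text \<open>
  The \<open>O(1)\<close> truncation errors at the two interface rows cost no accuracy because these
  two errors form a discrete dipole. For the error \<open>E = U - u\<^sub>h\<close>, extended by
  zero to the boundary nodes, let \<open>q\<^sub>i = B\<^sub>i (E\<^sub>i\<^sub>+\<^sub>1 - E\<^sub>i)\<close> be its numerical flux through the face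
  \<open>i + 1/2\<close>. In conservative form the equation \<open>L\<^sub>h E = - \<tau>\<close> reads \<open>q\<^sub>i - q\<^sub>i\<^sub>-\<^sub>1 = h\<^sup>2 \<tau>\<^sub>i\<close>, so it
  can be integrated once: \<open>q\<^sub>i = q\<^sub>0 + h\<^sup>2 P\<^sub>i\<close> with the partial sums \<open>P\<^sub>i = \<tau>\<^sub>1 + \<dots> + \<tau>\<^sub>i\<close>
  (lemma \<open>flux_eq_partial_sums\<close>).

  Since \<open>\<tau>\<^sub>I\<close> and \<open>\<tau>\<^sub>I\<^sub>+\<^sub>1\<close> cancel up to \<open>O(h)\<close>, every partial sum is \<open>O(h)\<close>, except the single one
  that ends between them, \<open>P\<^sub>I = O(1)\<close> (lemma \<open>dipole_partial_sum_bound\<close>). As there are \<open>n + 1 = O(1/h)\<close>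
  faces, \<open>\<Sum>\<^sub>j \<bar>P\<^sub>j\<bar> = O(1)\<close>.

  A second summation, with the two zero boundary values eliminating the unknown \<open>q\<^sub>0\<close>, gives
  \<open>\<bar>E\<^sub>i\<bar> \<le> (2 / \<beta>min) h\<^sup>2 \<Sum>\<^sub>j \<bar>P\<^sub>j\<bar> = O(h\<^sup>2)\<close> (lemma \<open>discrete_stability\<close>). The finitely many coarse
  grids on which the asymptotic bounds need not yet hold only enlarge the constant.
\<close>

text \<open>
  Stability in terms of the integrated source \<open>S\<close>. With \<open>T i = (\<Sum>j<i. S j / B j)\<close> and
  \<open>R i = (\<Sum>j<i. 1 / B j)\<close> summation of the fluxes gives \<open>E i = c R i + T i\<close>, and \<open>E (n + 1) = 0\<close>
  determines \<open>c\<close>, whence \<open>E i = T i - (R i / R (n + 1)) T (n + 1)\<close> with a quotient in the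
  unit interval. Only this quotient and the bound \<open>1 / B j \<le> 1 / m\<close> enter, which is why the
  constant depends on \<open>m\<close> alone.
\<close>

lemma discrete_stability:
  fixes E B S :: "nat \<Rightarrow> real" and m c :: real
  assumes m: "m > 0" and B: "\<And>i. i \<le> n \<Longrightarrow> B i \<ge> m"
    and left: "E 0 = 0" and right: "E (Suc n) = 0"
    and flux: "\<And>i. i \<le> n \<Longrightarrow> B i * (E (Suc i) - E i) = c + S i"
    and i: "i \<le> Suc n"
  shows "\<bar>E i\<bar> \<le> 2 / m * (\<Sum>j\<le>n. \<bar>S j\<bar>)"
proof -
  define R where "R i = (\<Sum>j<i. 1 / B j)" for i
  define T where "T i = (\<Sum>j<i. S j / B j)" for i
  define X where "X = (\<Sum>j\<le>n. \<bar>S j\<bar>) / m"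
  have Bpos: "B j > 0" if "j \<le> n" for j
    using B[OF that] m by linarith
  have E_eq: "E k = c * R k + T k" if "k \<le> Suc n" for k
    using that
  proof (induction k)
    case 0
    show ?case by (simp add: R_def T_def left)
  next
    case (Suc k)
    have "E (Suc k) = E k + (c + S k) / B k"
      using flux[of k] Bpos[of k] Suc.prems by (simp add: field_simps)
    with Suc show ?case
      by (simp add: R_def T_def field_simps add_divide_distrib)
  qed
  have T_bound: "\<bar>T k\<bar> \<le> X" if "k \<le> Suc n" for k
  proof -
    have "\<bar>T k\<bar> \<le> (\<Sum>j<k. \<bar>S j / B j\<bar>)"
      unfolding T_def by (rule sum_abs)
    also have "\<dots> \<le> (\<Sum>j<k. \<bar>S j\<bar> / m)"
    proof (rule sum_mono)
      fix j assume "j \<in> {..<k}"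
      then have "j \<le> n" using that by auto
      then show "\<bar>S j / B j\<bar> \<le> \<bar>S j\<bar> / m"
        using B[of j] Bpos[of j] m by (simp add: abs_divide frac_le)
    qed
    also have "\<dots> \<le> (\<Sum>j\<le>n. \<bar>S j\<bar> / m)"
      using that m by (intro sum_mono2) auto
    finally show ?thesis by (simp add: X_def sum_divide_distrib)
  qed
  have R_pos: "R (Suc n) > 0"
    unfolding R_def by (rule sum_pos) (use Bpos in auto)
  have R_nonneg: "0 \<le> R i"
    unfolding R_def by (rule sum_nonneg) (use Bpos i in \<open>auto simp: less_imp_le\<close>)
  have R_le: "R i \<le> R (Suc n)"
    unfolding R_def using i Bpos by (intro sum_mono2) (auto simp: less_imp_le)
  define \<theta> where "\<theta> = R i / R (Suc n)"
  have \<theta>: "0 \<le> \<theta>" "\<theta> \<le> 1"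
    using R_pos R_nonneg R_le by (auto simp: \<theta>_def)
  have "c = - T (Suc n) / R (Suc n)"
    using E_eq[of "Suc n"] right R_pos by (simp add: field_simps)
  then have "E i = T i - \<theta> * T (Suc n)"
    using E_eq[OF i] by (simp add: \<theta>_def)
  then have "\<bar>E i\<bar> \<le> \<bar>T i\<bar> + \<theta> * \<bar>T (Suc n)\<bar>"
    using abs_triangle_ineq4[of "T i" "\<theta> * T (Suc n)"] \<theta> by (simp add: abs_mult)
  also have "\<dots> \<le> X + X"
    using T_bound[OF i] T_bound[of "Suc n"] \<theta> mult_left_le_one_le[of "\<bar>T (Suc n)\<bar>" \<theta>]
    by linarith
  finally show ?thesis by (simp add: X_def)
qed

lemma flux_eq_partial_sums:
  fixes q t :: "nat \<Rightarrow> real" and d :: real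
  assumes "\<And>i. i \<in> {1..n} \<Longrightarrow> q i = q (i - 1) + d * t i" and "i \<le> n"
  shows "q i = q 0 + d * (\<Sum>k=1..i. t k)"
  using assms(2)
proof (induction i)
  case (Suc i)
  then show ?case using assms(1)[of "Suc i"] by (simp add: algebra_simps)
qed simp

text \<open>
  A partial sum sees none of the pair \<open>{I, I + 1}\<close>, or all of it, and then only the small
  sum of the pair counts; the one exception is the sum ending at \<open>I\<close>, which cuts the pair.
\<close>

lemma dipole_partial_sum_bound:
  fixes t :: "nat \<Rightarrow> real" and n I :: nat and \<epsilon> \<delta> K1 :: real
  assumes I: "1 \<le> I" and i: "i \<le> n"
    and regular: "\<And>k. k \<in> {1..n} - {I, I + 1} \<Longrightarrow> \<bar>t k\<bar> \<le> \<epsilon>" and "\<epsilon> \<ge> 0"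
    and single: "\<bar>t I\<bar> \<le> K1"
    and pair: "\<bar>t I + t (I + 1)\<bar> \<le> \<delta>"
  shows "\<bar>\<Sum>k=1..i. t k\<bar> \<le> n * \<epsilon> + \<delta> + (if i = I then K1 else 0)"
proof -
  let ?A = "{1..i} - {I, I + 1}" and ?P = "{1..i} \<inter> {I, I + 1}"
  have "\<bar>sum t ?A\<bar> \<le> (\<Sum>k\<in>?A. \<epsilon>)"
    by (rule order_trans[OF sum_abs], rule sum_mono) (use regular i in auto)
  also have "\<dots> \<le> (\<Sum>k\<in>{1..n}. \<epsilon>)"
    using i \<open>\<epsilon> \<ge> 0\<close> by (intro sum_mono2) auto
  finally have A: "\<bar>sum t ?A\<bar> \<le> n * \<epsilon>" by simp
  consider "i < I" | "i = I" | "I < i" by linarith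
  then have P: "\<bar>sum t ?P\<bar> \<le> \<delta> + (if i = I then K1 else 0)"
  proof cases
    case 1
    then have "?P = {}" by auto
    with 1 pair show ?thesis by simp
  next
    case 2
    then have "?P = {I}" using I by auto
    with 2 pair single show ?thesis by simp
  next
    case 3
    then have "?P = {I, I + 1}" using I by auto
    with 3 pair show ?thesis by simp
  qed
  have "(\<Sum>k=1..i. t k) = sum t ?P + sum t ?A"
    by (rule sum.Int_Diff) simp
  with A P show ?thesis by linarith
qed

text \<open>
  Each row of \<open>h\<^sup>2 L\<^sub>h\<close> is a difference of two face fluxes, so the error equation
  \<open>L\<^sub>h (U - u\<^sub>h) = - \<tau>\<close> can be summed. The index \<open>Suc (i - 1)\<close> is left as it stands to
  make both sides instances of the same flux expression.
\<close>

lemma error_flux_recursion: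
  fixes U V B :: "nat \<Rightarrow> real" and n :: nat and h t :: real
  defines "E \<equiv> \<lambda>i. zero_ext n U i - zero_ext n V i"
  assumes "h > 0" and "i \<in> {1..n}"
    and "flux_op h n B V i - flux_op h n B U i = t"
  shows "B i * (E (Suc i) - E i) = B (i - 1) * (E (Suc (i - 1)) - E (i - 1)) + h\<^sup>2 * t"
proof -
  have "h\<^sup>2 * flux_op h n B W i =
      B (i - 1) * (zero_ext n W i - zero_ext n W (i - 1))
      - B i * (zero_ext n W (Suc i) - zero_ext n W i)" for W
    using \<open>h > 0\<close> by (simp add: flux_op_def algebra_simps)
  moreover have "h\<^sup>2 * t = h\<^sup>2 * flux_op h n B V i - h\<^sup>2 * flux_op h n B U i"
    using assms(4) by (simp flip: right_diff_distrib)
  ultimately have "h\<^sup>2 * t =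
      (B (i - 1) * (zero_ext n V i - zero_ext n V (i - 1))
        - B i * (zero_ext n V (Suc i) - zero_ext n V i))
      - (B (i - 1) * (zero_ext n U i - zero_ext n U (i - 1))
        - B i * (zero_ext n U (Suc i) - zero_ext n U i))"
    by (simp only:)
  with \<open>i \<in> {1..n}\<close> show ?thesis
    by (simp add: E_def algebra_simps)
qed

lemma mesh_pos: "a < b \<Longrightarrow> mesh a b n > 0"
  by (simp add: mesh_def)

lemma mesh_count: "(real n + 1) * mesh a b n = b - a"
  by (simp add: mesh_def)

text \<open>
  The constant arises as follows: each of the \<open>n + 1 = (b - a) / h\<close> partial sums of
  truncation errors contributes at most \<open>((b - a) K + K2) h\<close>, and the exceptional one in
  addition \<open>K1\<close>; the factor \<open>2 / m\<close> comes from stability.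
\<close>

lemma single_grid_error_bound:
  fixes U V B t :: "nat \<Rightarrow> real" and m K K1 K2 :: real
  assumes "a < b" and m: "m > 0" and B: "\<And>i. i \<le> n \<Longrightarrow> B i \<ge> m"
    and I: "1 \<le> I" "I \<le> n"
    and error: "\<And>i. i \<in> {1..n} \<Longrightarrow>
      flux_op (mesh a b n) n B V i - flux_op (mesh a b n) n B U i = t i"
    and "K \<ge> 0" and regular: "\<And>i. i \<in> {1..n} - {I, I + 1} \<Longrightarrow> \<bar>t i\<bar> \<le> K * (mesh a b n)\<^sup>2"
    and single: "\<bar>t I\<bar> \<le> K1"
    and pair: "\<bar>t I + t (I + 1)\<bar> \<le> K2 * mesh a b n"
  shows "max_norm n (\<lambda>i. U i - V i)
    \<le> 2 / m * ((b - a) * ((b - a) * K + K2) + K1) * (mesh a b n)\<^sup>2"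
proof -
  define h where "h = mesh a b n"
  define E where "E = (\<lambda>i. zero_ext n U i - zero_ext n V i)"
  define q where "q i = B i * (E (Suc i) - E i)" for i
  define P where "P i = (\<Sum>k=1..i. t k)" for i
  define C where "C = (b - a) * ((b - a) * K + K2) + K1"
  have h: "h > 0" and nh: "(real n + 1) * h = b - a"
    using mesh_pos[OF \<open>a < b\<close>] mesh_count by (simp_all add: h_def)
  have q: "q i = q 0 + h\<^sup>2 * P i" if "i \<le> n" for i
    unfolding P_def
  proof (rule flux_eq_partial_sums[OF _ that])
    fix i assume "i \<in> {1..n}"
    then show "q i = q (i - 1) + h\<^sup>2 * t i"
      unfolding q_def E_def h_def
      using error mesh_pos[OF \<open>a < b\<close>] by (intro error_flux_recursion) auto
  qed
  have P_bound: "\<bar>P i\<bar> \<le> ((b - a) * K + K2) * h + (if i = I then K1 else 0)" if "i \<le> n" for i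
  proof -
    have "\<bar>P i\<bar> \<le> n * (K * h\<^sup>2) + K2 * h + (if i = I then K1 else 0)"
      unfolding P_def
      by (rule dipole_partial_sum_bound) (use I that regular single pair \<open>K \<ge> 0\<close> in \<open>auto simp: h_def\<close>)
    moreover have "real n * (K * h\<^sup>2) \<le> (real n + 1) * (K * h\<^sup>2)"
      using \<open>K \<ge> 0\<close> by (intro mult_right_mono) auto
    moreover have "(real n + 1) * (K * h\<^sup>2) = ((real n + 1) * h) * (K * h)"
      by (simp only: power2_eq_square ac_simps)
    ultimately show ?thesis
      unfolding nh by (simp add: algebra_simps)
  qed
  have "(\<Sum>j\<le>n. \<bar>P j\<bar>) \<le> (\<Sum>j\<le>n. ((b - a) * K + K2) * h + (if j = I then K1 else 0))"
    by (rule sum_mono) (use P_bound in auto)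
  also have "\<dots> = (real n + 1) * (((b - a) * K + K2) * h) + K1"
    using I by (subst sum.distrib) (simp add: add.commute)
  also have "\<dots> = ((real n + 1) * h) * ((b - a) * K + K2) + K1"
    by (simp only: ac_simps)
  finally have sum_P: "(\<Sum>j\<le>n. \<bar>P j\<bar>) \<le> C"
    unfolding nh C_def .
  have E_bound: "\<bar>U i - V i\<bar> \<le> 2 / m * C * h\<^sup>2" if "i \<in> {1..n}" for i
  proof -
    have "\<bar>E i\<bar> \<le> 2 / m * (\<Sum>j\<le>n. \<bar>h\<^sup>2 * P j\<bar>)"
    proof (rule discrete_stability[OF m B, where c = "q 0"])
      show "B i * (E (Suc i) - E i) = q 0 + h\<^sup>2 * P i" if "i \<le> n" for i
        using q[OF that] by (simp only: q_def)
    qed (use that in \<open>auto simp: E_def zero_ext_def\<close>)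
    also have "(\<Sum>j\<le>n. \<bar>h\<^sup>2 * P j\<bar>) = h\<^sup>2 * (\<Sum>j\<le>n. \<bar>P j\<bar>)"
      by (simp add: abs_mult sum_distrib_left)
    also have "2 / m * (h\<^sup>2 * (\<Sum>j\<le>n. \<bar>P j\<bar>)) \<le> 2 / m * (h\<^sup>2 * C)"
      using sum_P m by (intro mult_left_mono) auto
    finally show ?thesis
      using that by (simp add: E_def zero_ext_def mult_ac)
  qed
  have "max_norm n (\<lambda>i. U i - V i) \<le> 2 / m * C * h\<^sup>2"
    unfolding max_norm_def using I E_bound by (intro Max.boundedI) auto
  then show ?thesis by (simp add: C_def h_def)
qed

lemma eventually_refine_iff:
  "eventually Q (refine N) \<longleftrightarrow> (\<exists>n0. \<forall>n\<ge>n0. n \<in> N \<longrightarrow> Q n)"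
  by (simp add: refine_def eventually_inf_principal eventually_sequentially)

text \<open>
  Only finitely many indices precede the range of validity of an asymptotic bound, and their
  quotients \<open>e n / g n\<close> can be absorbed into the constant.
\<close>

lemma eventual_bound_imp_uniform_bound:
  fixes e g :: "nat \<Rightarrow> real" and C :: real
  assumes "\<forall>\<^sub>F n in refine N. e n \<le> C * g n" and g: "\<And>n. g n > 0"
  shows "\<exists>C. \<forall>n\<in>N. e n \<le> C * g n"
proof -
  obtain n0 where n0: "\<And>n. n \<ge> n0 \<Longrightarrow> n \<in> N \<Longrightarrow> e n \<le> C * g n"
    using assms(1) by (auto simp: eventually_refine_iff)
  define D where "D = Max (insert C ((\<lambda>n. e n / g n) ` {..<n0}))"
  have "e n \<le> D * g n" if "n \<in> N" for n
  proof (cases "n < n0")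
    case True
    then have "e n / g n \<le> D"
      unfolding D_def by (intro Max_ge) auto
    then show ?thesis using g[of n] by (simp add: pos_divide_le_eq)
  next
    case False
    have "C \<le> D" unfolding D_def by (intro Max_ge) auto
    then have "C * g n \<le> D * g n"
      using g[of n] by (intro mult_right_mono) auto
    with n0[of n] False that show ?thesis by simp
  qed
  then show ?thesis by blast
qed

theorem theorem4p3:
  fixes a \<alpha> b \<beta>m \<beta>p w v \<beta>min :: real
    and f u :: "real \<Rightarrow> real"
    and N :: "nat set"
    and I :: "nat \<Rightarrow> nat"
    and B U r :: "nat \<Rightarrow> nat \<Rightarrow> real"
    and \<tau> :: "nat \<Rightarrow> nat \<Rightarrow> real"
  assumes "a < \<alpha>" and "\<alpha> < b" and "\<beta>m > 0" and "\<beta>p > 0"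
    and "interface_solution a \<alpha> b \<beta>m \<beta>p f w v u"
    and "\<And>n. n \<in> N \<Longrightarrow> 1 \<le> I n \<and> I n \<le> n - 1"
    and "\<And>n. n \<in> N \<Longrightarrow> grid a b n (I n) < \<alpha> \<and> \<alpha> < grid a b n (I n + 1)"
    and "\<beta>min > 0"
    and "\<And>n i. n \<in> N \<Longrightarrow> i \<le> n \<Longrightarrow> B n i \<ge> \<beta>min"
    and "\<And>n i. n \<in> N \<Longrightarrow> i \<in> {1..n} - {I n, I n + 1} \<Longrightarrow> r n i = f (grid a b n i)"
    and "\<And>n i. n \<in> N \<Longrightarrow> i \<in> {1..n} \<Longrightarrow> flux_op (mesh a b n) n (B n) (U n) i = r n i"
    and "\<tau> = (\<lambda>n. trunc_error a b n (B n) (r n) u)"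
    and "\<exists>K. \<forall>\<^sub>F n in refine N. \<forall>i \<in> {1..n} - {I n, I n + 1}. \<bar>\<tau> n i\<bar> \<le> K * (mesh a b n)\<^sup>2"
    and "(\<lambda>n. \<tau> n (I n)) \<in> O[refine N](\<lambda>n. 1)"
    and "(\<lambda>n. \<tau> n (I n + 1)) \<in> O[refine N](\<lambda>n. 1)"
    and "(\<lambda>n. \<tau> n (I n) + \<tau> n (I n + 1)) \<in> O[refine N](\<lambda>n. mesh a b n)"
  shows "\<exists>C. \<forall>n \<in> N. max_norm n (\<lambda>i. U n i - u (grid a b n i)) \<le> C * (mesh a b n)\<^sup>2"
proof -
  note interior = assms(6) and coeff = assms(9) and scheme = assms(11) and \<tau> = assms(12)
  have ab: "a < b" using assms(1,2) by simp
  obtain K0 where K0: "\<forall>\<^sub>F n in refine N. \<forall>i \<in> {1..n} - {I n, I n + 1}. \<bar>\<tau> n i\<bar> \<le> K0 * (mesh a b n)\<^sup>2"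
    using assms(13) by blast
  obtain K1 where K1: "\<forall>\<^sub>F n in refine N. \<bar>\<tau> n (I n)\<bar> \<le> K1"
    using assms(14) by (elim landau_o.bigE) auto
  obtain K2 where K2: "\<forall>\<^sub>F n in refine N. \<bar>\<tau> n (I n) + \<tau> n (I n + 1)\<bar> \<le> K2 * mesh a b n"
    using assms(16) mesh_pos[OF ab] by (elim landau_o.bigE) (auto simp: abs_of_pos)
  \<comment> \<open>a bound whose sign is known, so that it can be summed over more rows than occur\<close>
  define K where "K = max K0 0"
  have "\<forall>\<^sub>F n in refine N. n \<in> N"
    by (auto simp: eventually_refine_iff)
  with K0 K1 K2 have "\<forall>\<^sub>F n in refine N. max_norm n (\<lambda>i. U n i - u (grid a b n i))
      \<le> 2 / \<beta>min * ((b - a) * ((b - a) * K + K2) + K1) * (mesh a b n)\<^sup>2"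
  proof eventually_elim
    case (elim n)
    show ?case
    proof (rule single_grid_error_bound[OF ab \<open>\<beta>min > 0\<close>])
      show "B n i \<ge> \<beta>min" if "i \<le> n" for i
        using coeff elim(4) that by blast
      show "1 \<le> I n" "I n \<le> n" using interior[OF elim(4)] by auto
      show "flux_op (mesh a b n) n (B n) (\<lambda>i. u (grid a b n i)) i
          - flux_op (mesh a b n) n (B n) (U n) i = \<tau> n i" if "i \<in> {1..n}" for i
        using scheme[OF elim(4) that] by (simp add: \<tau> trunc_error_def)
      show "\<bar>\<tau> n i\<bar> \<le> K * (mesh a b n)\<^sup>2" if "i \<in> {1..n} - {I n, I n + 1}" for i
      proof -
        have "K0 * (mesh a b n)\<^sup>2 \<le> K * (mesh a b n)\<^sup>2"
          by (intro mult_right_mono) (auto simp: K_def)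
        with elim(1) that show ?thesis by force
      qed
    qed (use elim in \<open>auto simp: K_def\<close>)
  qed
  then show ?thesis
    by (rule eventual_bound_imp_uniform_bound) (rule zero_less_power[OF mesh_pos[OF ab]])
qed

end
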